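(* Let $\Phi:\mathbb{R}\times\mathbb{R}^2\to\mathbb{R}^2$ be a continuous flow, let $A\subset\mathbb{R}^2$ be a regular open set whose boundary $\partial A$ is a Jordan curve, let $c:[0,1)\to\partial A$ be a parametrization of $\partial A$, and let $F_E:[0,1)\to[0,1)$ be the parametric representation of the first-out map $E_A$, i.e. the partial map given by $c(F_E(s))=E_A(c(s))$. If $F_E$ is continuous at $s$ (with $s\in\mathrm{dom}\,F_E$) and $F_E(s)\neq s$, then there exists $\delta>0$ such that, for $t\in\mathrm{dom}\,F_E$, $F_E(t)>F_E(s)$ whenever $s-\delta<t<s$, and $F_E(t)<F_E(s)$ whenever $s<t<s+\delta$.
   Context: A flow on a topological space $X$ is a continuous map $\Phi:\mathbb{R}\times X\to X$ with $\Phi(0,x)=x$ and $\Phi(s+t,x)=\Phi(s,\Phi(t,x))$. An open set $A$ is regular if $\partial A=\partial\bar A$. A partial map is a map defined on a subset (its domain $\mathrm{dom}$) of its source; continuity at a point of the domain refers to the subspace topology on the domain. First-out map: for an open set $A$, $E_A:\partial A\to\partial A$ is the partial map $E_A(x)=\Phi(T^e_A(x),x)$, where $T^e_A(x)=\inf\{t>0\mid\Phi(t,x)\notin A\}$; $x\in\mathrm{dom}\,E_A$ iff this set of times is nonempty. A parametrization $c:[0,1)\to\partial A$ of the Jordan curve $\partial A$ is a continuous bijection that extends continuously to $[0,1]$ with $c(1)=c(0)$. $F_E$ is defined at $s$ iff $E_A$ is defined at $c(s)$. *)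

theory Defs
  imports "HOL-Analysis.Analysis"
begin

definition continuous_flow :: "(real \<Rightarrow> 'a::topological_space \<Rightarrow> 'a) \<Rightarrow> bool" where
  "continuous_flow \<Phi> \<longleftrightarrow>
     continuous_on UNIV (\<lambda>(t, x). \<Phi> t x) \<and>
     (\<forall>x. \<Phi> 0 x = x) \<and>
     (\<forall>s t x. \<Phi> (s + t) x = \<Phi> s (\<Phi> t x))"

definition regular_open :: "'a::topological_space set \<Rightarrow> bool" where
  "regular_open A \<longleftrightarrow> open A \<and> frontier A = frontier (closure A)"

definition Jordan_curve_set :: "'a::real_normed_vector set \<Rightarrow> bool" where
  "Jordan_curve_set J \<longleftrightarrow>
     (\<exists>\<gamma>. simple_path \<gamma> \<and> pathfinish \<gamma> = pathstart \<gamma> \<and> path_image \<gamma> = J)"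

(* Partial maps are option-valued; dom and ran are those of HOL.Map. *)

definition exit_times :: "(real \<Rightarrow> 'a \<Rightarrow> 'a) \<Rightarrow> 'a set \<Rightarrow> 'a \<Rightarrow> real set" where
  "exit_times \<Phi> A x = {t. t > 0 \<and> \<Phi> t x \<notin> A}"

definition exit_time :: "(real \<Rightarrow> 'a \<Rightarrow> 'a) \<Rightarrow> 'a set \<Rightarrow> 'a \<Rightarrow> real" where
  "exit_time \<Phi> A x = Inf (exit_times \<Phi> A x)"

definition first_out_map ::
    "(real \<Rightarrow> 'a \<Rightarrow> 'a) \<Rightarrow> 'a::topological_space set \<Rightarrow> 'a \<rightharpoonup> 'a" where
  "first_out_map \<Phi> A x =
     (if x \<in> frontier A \<and> exit_times \<Phi> A x \<noteq> {} then Some (\<Phi> (exit_time \<Phi> A x) x) else None)"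

(* The interval [0,1) is {0..<1}; values of c outside it are irrelevant. *)

definition parametrization :: "(real \<Rightarrow> 'a::topological_space) \<Rightarrow> 'a set \<Rightarrow> bool" where
  "parametrization c J \<longleftrightarrow>
     continuous_on {0..<1} c \<and> bij_betw c {0..<1} J \<and>
     (\<exists>g. continuous_on {0..1} g \<and> (\<forall>s\<in>{0..<1}. g s = c s) \<and> g 1 = g 0)"

definition parametric_rep :: "(real \<Rightarrow> 'a) \<Rightarrow> ('a \<rightharpoonup> 'a) \<Rightarrow> (real \<rightharpoonup> real) \<Rightarrow> bool" where
  "parametric_rep c E F \<longleftrightarrow>
     dom F = {s \<in> {0..<1}. c s \<in> dom E} \<and>
     ran F \<subseteq> {0..<1} \<and>
     (\<forall>s\<in>dom F. E (c s) = Some (c (the (F s))))"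

lemma ran_first_out_map:
  assumes "continuous_flow \<Phi>" "open A"
  shows "ran (first_out_map \<Phi> A) \<subseteq> frontier A"
proof
  fix y assume "y \<in> ran (first_out_map \<Phi> A)"
  then obtain x where x: "x \<in> frontier A" and ne: "exit_times \<Phi> A x \<noteq> {}"
    and y: "y = \<Phi> (exit_time \<Phi> A x) x"
    by (auto simp: ran_def first_out_map_def split: if_splits)
  define S T where "S = exit_times \<Phi> A x" and "T = exit_time \<Phi> A x"
  have TS: "T = Inf S" by (simp add: T_def S_def exit_time_def)
  have bdd: "bdd_below S" by (auto simp: S_def exit_times_def intro!: bdd_belowI[of _ 0])
  have "continuous_on UNIV ((\<lambda>(t, x). \<Phi> t x) \<circ> (\<lambda>t. (t, x)))"
    using assms(1) unfolding continuous_flow_def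
    by (intro continuous_on_compose) (auto intro!: continuous_intros elim: continuous_on_subset)
  then have cont: "continuous_on UNIV (\<lambda>t. \<Phi> t x)" by (simp add: o_def)
  have "closed ((\<lambda>t. \<Phi> t x) -` (- A))"
    using cont assms(2) by (intro continuous_closed_vimage) (auto simp: continuous_on_eq_continuous_at)
  moreover have "S \<subseteq> (\<lambda>t. \<Phi> t x) -` (- A)" by (auto simp: S_def exit_times_def)
  moreover have "T \<in> closure S"
    unfolding TS using ne bdd by (intro closure_contains_Inf) (auto simp: S_def)
  ultimately have notA: "\<Phi> T x \<notin> A" using closure_minimal by blast
  have T0: "T \<ge> 0"
    unfolding TS using ne by (intro cInf_greatest) (auto simp: S_def exit_times_def)
  show "y \<in> frontier A"
  proof (cases "T = 0")
    case True
    then show ?thesis using x y assms(1) by (simp add: T_def continuous_flow_def)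
  next
    case False
    with T0 have "T > 0" by simp
    have inA: "\<Phi> t x \<in> A" if "0 < t" "t < T" for t
      using that cInf_lower[OF _ bdd, of t] by (force simp: TS S_def exit_times_def)
    have "T \<in> closure {0<..<T}" using \<open>T > 0\<close> by simp
    then have "\<Phi> T x \<in> closure ((\<lambda>t. \<Phi> t x) ` {0<..<T})"
      using continuous_image_closure_subset[OF cont, of "{0<..<T}"] by auto
    then have "\<Phi> T x \<in> closure A"
      by (rule rev_subsetD[OF _ closure_mono]) (auto intro: inA)
    then show ?thesis
      using notA assms(2) y by (simp add: frontier_def interior_open T_def)
  qed
qed

lemma parametric_rep_exists:
  assumes "bij_betw c {0..<1} J" "ran E \<subseteq> J"
  shows "\<exists>F. parametric_rep c E F"
proof
  let ?F = "\<lambda>s. if s \<in> {0..<1} \<and> c s \<in> dom E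
                then Some (the_inv_into {0..<1} c (the (E (c s)))) else None"
  have "the_inv_into {0..<1} c y \<in> {0..<1} \<and> c (the_inv_into {0..<1} c y) = y" if "y \<in> J" for y
    using that assms(1) f_the_inv_into_f_bij_betw[OF assms(1)]
      bij_betw_the_inv_into[OF assms(1)] by (auto dest: bij_betwE)
  moreover have "y \<in> J" if "E x = Some y" for x y
    using that assms(2) by (auto simp: ran_def)
  ultimately show "parametric_rep c E ?F"
    unfolding parametric_rep_def by (fastforce simp: dom_def ran_def split: if_splits)
qed

lemma parametric_rep_unique:
  assumes "inj_on c {0..<1}" "parametric_rep c E F" "parametric_rep c E G"
  shows "F = G"
proof
  fix s
  show "F s = G s"
  proof (cases "s \<in> dom F")
    case False
    then show ?thesis using assms(2,3) unfolding parametric_rep_def by (metis domIff)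
  next
    case True
    then obtain u v where uv: "F s = Some u" "G s = Some v"
      using assms(2,3) unfolding parametric_rep_def by blast
    then have "u \<in> {0..<1}" "v \<in> {0..<1}" "c u = c v"
      using assms(2,3) ranI[of F s u] ranI[of G s v] domI[of F s u] domI[of G s v]
      unfolding parametric_rep_def by (blast, blast, metis option.sel)
    then show ?thesis using uv inj_onD[OF assms(1)] by simp
  qed
qed

end

theory Submission
  imports Defs
begin

text \<open>
  Where it is not the identity, the first-out map joins its argument to its value by an orbit
  segment that runs through A, and the segments of two different points near s are disjoint. So it
  suffices that the endpoints of two disjoint crosscuts of A do not separate each other on the
  boundary curve J. Let \<alpha> be a crosscut and J1, J2 the arcs into which its endpoints cut J. The
  set (J1 \<union> \<alpha>) \<inter> (J2 \<union> \<alpha>) = \<alpha> is connected, so by Janiszewski's theorem two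
  points that are separated neither by J1 \<union> \<alpha> nor by J2 \<union> \<alpha> are not separated by
  J \<union> \<alpha>. A crosscut disjoint from \<alpha> with one endpoint in each of J1 and J2, continued
  through the connected complement of the closure of A, would join a point of A to a point off the
  closure of A outside each of these sets, although J separates the two points.
\<close>

section \<open>Planar topology\<close>

text \<open>A linear isomorphism with the complex plane is a homeomorphism, so compactness,
  connectedness and separation carry over from Janiszewski's theorem there.\<close>

lemma Janiszewski_DIM_2:
  fixes a b :: "'a::euclidean_space"
  assumes dim: "DIM('a) = 2"
    and S: "compact S" and T: "compact T" and ST: "connected (S \<inter> T)"
    and a: "connected_component (- S) a b" and b: "connected_component (- T) a b"
  shows "connected_component (- (S \<union> T)) a b"
proof -
  have "DIM('a) = DIM(complex)" using dim by simp
  then obtain f :: "'a \<Rightarrow> complex" and g where lin: "linear f" "linear g"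
    and gf: "\<And>x. g (f x) = x" and fg: "\<And>y. f (g y) = y"
    using isomorphisms_UNIV_UNIV by metis
  have cf: "continuous_on X f" and cg: "continuous_on Y g" for X Y
    using lin by (simp_all add: linear_continuous_on linear_linear)
  have inj: "inj f" by (metis gf injI)
  have img: "f ` (- X) = - f ` X" for X
    by (rule bij_image_Compl_eq) (metis bijI' fg gf)
  have tr: "connected_component (- f ` X) (f a) (f b)" if X: "connected_component (- X) a b" for X
  proof -
    obtain C where C: "connected C" "C \<subseteq> - X" "a \<in> C" "b \<in> C"
      using X unfolding connected_component_def by blast
    have "connected (f ` C)" by (rule connected_continuous_image[OF cf C(1)])
    moreover have "f ` C \<subseteq> - f ` X" using image_mono[OF C(2), of f] img by simp
    ultimately show ?thesis unfolding connected_component_def using C(3,4) by blast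
  qed
  have "connected_component (- (f ` S \<union> f ` T)) (f a) (f b)"
  proof (rule Janiszewski)
    show "compact (f ` S)" "closed (f ` T)"
      by (intro compact_imp_closed compact_continuous_image cf S T)+
    show "connected (f ` S \<inter> f ` T)"
      using connected_continuous_image[OF cf ST] by (simp add: image_Int[OF inj])
  qed (rule tr a b)+
  then obtain C where C: "connected C" "C \<subseteq> - f ` (S \<union> T)" "f a \<in> C" "f b \<in> C"
    unfolding connected_component_def image_Un by blast
  have "g y \<notin> S \<union> T" if "y \<in> C" for y
    using C(2) that by (metis ComplD fg imageI subsetD)
  moreover have "a \<in> g ` C" "b \<in> g ` C" using C(3,4) gf by (metis imageI)+
  moreover have "connected (g ` C)" using connected_continuous_image[OF cg C(1)] .
  ultimately have "connected (g ` C)" "g ` C \<subseteq> - (S \<union> T)" "a \<in> g ` C" "b \<in> g ` C" by auto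
  then show ?thesis unfolding connected_component_def by blast
qed

text \<open>The two pieces are the inside and the outside of the image of the curve in the complex
  plane, pulled back along a linear isomorphism.\<close>

lemma Jordan_curve_complement_DIM_2:
  fixes J :: "'a::euclidean_space set"
  assumes dim: "DIM('a) = 2" and J: "Jordan_curve_set J"
  obtains U V where "connected U" "connected V" "U \<union> V = - J"
proof -
  obtain \<gamma> where \<gamma>: "simple_path \<gamma>" "pathfinish \<gamma> = pathstart \<gamma>" "path_image \<gamma> = J"
    using J by (auto simp: Jordan_curve_set_def)
  have "DIM('a) = DIM(complex)" using dim by simp
  then obtain f :: "'a \<Rightarrow> complex" and g where lin: "linear f" "linear g"
    and gf: "\<And>x. g (f x) = x" and fg: "\<And>y. f (g y) = y"
    using isomorphisms_UNIV_UNIV by metis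
  have inj: "inj f" by (metis gf injI)
  have "simple_path (f \<circ> \<gamma>)" "pathfinish (f \<circ> \<gamma>) = pathstart (f \<circ> \<gamma>)"
    using \<gamma> lin inj by (simp_all add: simple_path_linear_image_eq pathfinish_compose pathstart_compose)
  from Jordan_inside_outside[OF this]
  have co: "connected (inside (f ` J))" "connected (outside (f ` J))"
    by (auto simp: path_image_compose \<gamma>(3))
  have cg: "continuous_on Y g" for Y
    using lin by (simp add: linear_continuous_on linear_linear)
  have "g ` inside (f ` J) \<union> g ` outside (f ` J) = g ` (- f ` J)"
    by (metis image_Un inside_Un_outside)
  also have "\<dots> = - g ` f ` J"
    by (rule bij_image_Compl_eq) (metis bijI' fg gf)
  also have "g ` f ` J = J" by (simp add: image_image gf)
  finally show thesis
    by (rule that[rotated 2]) (intro connected_continuous_image cg co)+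
qed

text \<open>Off the frontier the plane splits into the disjoint open sets \<open>A\<close> and
  \<open>- closure A\<close>, so each of the two connected pieces \<open>U\<close>, \<open>V\<close>
  lies in one of them. As \<open>A\<close> is nonempty, the exterior cannot take both pieces: it is
  empty or one of them.\<close>

lemma connected_exterior_regular_open:
  fixes A :: "'a::euclidean_space set"
  assumes dim: "DIM('a) = 2" and A: "regular_open A" and J: "Jordan_curve_set (frontier A)"
    and "A \<noteq> {}"
  shows "connected (- closure A)"
proof -
  obtain U V where U: "connected U" and V: "connected V" and UV: "U \<union> V = - frontier A"
    using Jordan_curve_complement_DIM_2[OF dim J] .
  have oA: "open A" using A by (simp add: regular_open_def)
  have eq: "U \<union> V = A \<union> - closure A"
    using UV oA closure_subset[of A] by (auto simp: frontier_def interior_open)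
  have dich: "W \<subseteq> A \<or> W \<subseteq> - closure A" if "connected W" "W \<subseteq> U \<union> V" for W
    using connectedD[OF that(1) oA, of "- closure A"] that(2) eq closure_subset[of A] by blast
  consider "U \<subseteq> A" "V \<subseteq> A" | "U \<subseteq> - closure A" | "V \<subseteq> - closure A"
    using dich[OF U] dich[OF V] by blast
  then show ?thesis
  proof cases
    case 1
    then have "- closure A = {}" using eq closure_subset[of A] by blast
    then show ?thesis by simp
  next
    case 2
    have "- closure A = U \<or> - closure A = U \<union> V"
      using 2 dich[OF V] eq closure_subset[of A] by blast
    moreover have "- closure A = U \<union> V \<Longrightarrow> A = {}"
      using eq closure_subset[of A] by blast
    ultimately show ?thesis using U \<open>A \<noteq> {}\<close> by auto
  next
    case 3
    have "- closure A = V \<or> - closure A = U \<union> V"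
      using 3 dich[OF U] eq closure_subset[of A] by blast
    moreover have "- closure A = U \<union> V \<Longrightarrow> A = {}"
      using eq closure_subset[of A] by blast
    ultimately show ?thesis using V \<open>A \<noteq> {}\<close> by auto
  qed
qed

text \<open>The frontier of \<open>closure A\<close> always lies in the closure of the exterior.
  What regularity excludes is seen in the plane without a circle: there the exterior is empty
  although the boundary is a Jordan curve.\<close>

lemma frontier_regular_open_subset_closure_exterior:
  assumes "regular_open A"
  shows "frontier A \<subseteq> closure (- closure A)"
  using assms unfolding regular_open_def
  by (metis Int_lower2 frontier_closures)

text \<open>The second crosscut enters as two connected pieces through a common point
  \<open>q\<close> of \<open>A\<close>. The piece ending in \<open>J1\<close> avoids
  \<open>J2\<close>, and vice versa, so each gives an escape from \<open>q\<close> to the exterior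
  past one of the two sets in Janiszewski's theorem.\<close>

lemma crosscuts_do_not_link:
  fixes A :: "'a::euclidean_space set"
  assumes dim: "DIM('a) = 2" and A: "regular_open A" and J: "Jordan_curve_set (frontier A)"
    and J12: "frontier A = J1 \<union> J2" "compact J1" "compact J2"
    and \<alpha>: "compact \<alpha>" "connected \<alpha>" "\<alpha> \<subseteq> closure A" "J1 \<inter> J2 \<subseteq> \<alpha>"
    and q: "q \<in> A"
    and \<beta>1: "connected \<beta>1" "x \<in> \<beta>1" "q \<in> \<beta>1" "\<beta>1 \<inter> (J2 \<union> \<alpha>) = {}" "x \<in> J1"
    and \<beta>2: "connected \<beta>2" "y \<in> \<beta>2" "q \<in> \<beta>2" "\<beta>2 \<inter> (J1 \<union> \<alpha>) = {}" "y \<in> J2"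
  shows False
proof -
  let ?B = "- closure A"
  have oA: "open A" using A by (simp add: regular_open_def)
  have coB: "connected ?B"
    using connected_exterior_regular_open[OF dim A J] q by blast
  have frB: "frontier A \<subseteq> closure ?B"
    by (rule frontier_regular_open_subset_closure_exterior[OF A])
  have "x \<in> frontier A" using J12(1) \<beta>1(5) by simp
  then have "?B \<noteq> {}" using frB by (metis closure_empty empty_iff subsetD)
  then obtain p where p: "p \<in> ?B" by blast
  have frA: "J1 \<union> J2 \<union> \<alpha> \<subseteq> closure A" using J12(1) \<alpha>(3) by (auto simp: frontier_def)
  \<comment> \<open>The exterior stays connected when the boundary point \<open>z\<close> is added,
    as \<open>z\<close> lies in its closure. So \<open>\<beta>\<close> leads from \<open>q\<close>
    to \<open>z\<close> and on to \<open>p\<close>.\<close>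
  have join: "connected_component (- (K \<union> \<alpha>)) q p"
    if "K \<subseteq> frontier A" "z \<in> frontier A" "connected \<beta>" "z \<in> \<beta>" "q \<in> \<beta>" "\<beta> \<inter> (K \<union> \<alpha>) = {}"
    for K \<beta> z
  proof -
    have "connected (insert z ?B)"
      by (rule connected_intermediate_closure[OF coB]) (use that frB closure_subset in blast)+
    then have "connected (\<beta> \<union> insert z ?B)"
      using that by (intro connected_Un) auto
    moreover have "\<beta> \<union> insert z ?B \<subseteq> - (K \<union> \<alpha>)"
      using that frA J12(1) by blast
    ultimately show ?thesis
      unfolding connected_component_def using that p by blast
  qed
  have "connected_component (- ((J1 \<union> \<alpha>) \<union> (J2 \<union> \<alpha>))) q p"
  proof (rule Janiszewski_DIM_2[OF dim])
    have "(J1 \<union> \<alpha>) \<inter> (J2 \<union> \<alpha>) = \<alpha>" using \<alpha>(4) by blast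
    then show "connected ((J1 \<union> \<alpha>) \<inter> (J2 \<union> \<alpha>))" using \<alpha>(2) by simp
    show "connected_component (- (J1 \<union> \<alpha>)) q p" using join[of J1 y \<beta>2] J12(1) \<beta>2 by blast
    show "connected_component (- (J2 \<union> \<alpha>)) q p" using join[of J2 x \<beta>1] J12(1) \<beta>1 by blast
  qed (use J12 \<alpha>(1) in \<open>auto intro: compact_Un\<close>)
  then obtain C where C: "connected C" "C \<subseteq> - frontier A" "q \<in> C" "p \<in> C"
    unfolding connected_component_def using J12(1) by blast
  have "C \<subseteq> A \<union> ?B" using C(2) oA closure_subset[of A] by (auto simp: frontier_def interior_open)
  then show False
    using connectedD[OF C(1) oA, of ?B] C q p closure_subset[of A] by blast
qed

section \<open>First-out map\<close>

lemma continuous_flow_orbit: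
  assumes "continuous_flow \<Phi>"
  shows "continuous_on S (\<lambda>t. \<Phi> t x)"
proof -
  have "continuous_on UNIV ((\<lambda>(t, x). \<Phi> t x) \<circ> (\<lambda>t. (t, x)))"
    using assms unfolding continuous_flow_def
    by (intro continuous_on_compose) (auto intro!: continuous_intros elim: continuous_on_subset)
  then show ?thesis by (auto simp: o_def intro: continuous_on_subset)
qed

text \<open>At exit time 0 the flow is the identity, so \<open>y \<noteq> x\<close> forces a
  positive exit time; no time below the infimum is an exit time.\<close>

lemma first_out_map_segment:
  assumes "continuous_flow \<Phi>" and "first_out_map \<Phi> A x = Some y" and "y \<noteq> x"
  obtains T where "T > 0" "\<Phi> T x = y" "\<And>t. 0 < t \<Longrightarrow> t < T \<Longrightarrow> \<Phi> t x \<in> A"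
proof
  let ?S = "exit_times \<Phi> A x" and ?T = "exit_time \<Phi> A x"
  have ne: "?S \<noteq> {}" and y: "\<Phi> ?T x = y"
    using assms(2) by (auto simp: first_out_map_def split: if_splits)
  show "\<Phi> ?T x = y" by fact
  have bdd: "bdd_below ?S" by (auto simp: exit_times_def intro!: bdd_belowI[of _ 0])
  have "?T \<ge> 0"
    unfolding exit_time_def using ne by (intro cInf_greatest) (auto simp: exit_times_def)
  moreover have "?T \<noteq> 0" using y assms(1,3) by (auto simp: continuous_flow_def)
  ultimately show "?T > 0" by simp
  show "\<Phi> t x \<in> A" if "0 < t" "t < ?T" for t
    using that cInf_lower[OF _ bdd, of t] by (force simp: exit_time_def exit_times_def)
qed

text \<open>If the segments met, flowing back from the common point would put the starting point of
  one of them on the other, at a time when the orbit is in \<open>A\<close> or at an end excluded by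
  assumption. In particular the final points differ.\<close>

lemma orbit_segments_disjoint:
  assumes flow: "continuous_flow \<Phi>" and "open A" and "x \<in> frontier A" "x' \<in> frontier A"
    and T: "\<And>t. 0 < t \<Longrightarrow> t < T \<Longrightarrow> \<Phi> t x \<in> A"
    and T': "\<And>t. 0 < t \<Longrightarrow> t < T' \<Longrightarrow> \<Phi> t x' \<in> A"
    and "x \<noteq> x'" "\<Phi> T x \<noteq> x'" "\<Phi> T' x' \<noteq> x"
  shows "(\<lambda>t. \<Phi> t x) ` {0..T} \<inter> (\<lambda>t. \<Phi> t x') ` {0..T'} = {}"
proof -
  have add: "\<Phi> (s + t) z = \<Phi> s (\<Phi> t z)" and zero: "\<Phi> 0 z = z" for s t z
    using flow by (auto simp: continuous_flow_def)
  have fr: "frontier A \<inter> A = {}" using \<open>open A\<close> by (auto simp: frontier_def interior_open)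
  \<comment> \<open>Stated for general \<open>z\<close>, \<open>z'\<close> so that it serves both
    orders of the two meeting times: the segment that has run longer contains the start of the
    other.\<close>
  have False if ab: "0 \<le> a" "a \<le> b" "b \<le> T" and eq: "\<Phi> a z' = \<Phi> b z"
    and z: "z' \<in> frontier A" "z \<noteq> z'" "\<Phi> T z \<noteq> z'"
    and T: "\<And>t. 0 < t \<Longrightarrow> t < T \<Longrightarrow> \<Phi> t z \<in> A" for a b z z' T
  proof -
    have "z' = \<Phi> (- a) (\<Phi> a z')" using add[of "- a" a z'] zero by simp
    also have "\<dots> = \<Phi> (b - a) z" using add[of "- a" b z] eq by simp
    finally have z': "z' = \<Phi> (b - a) z" .
    then have "b - a \<noteq> 0" "b - a \<noteq> T" using z zero by auto
    then show False using T[of "b - a"] z' z(1) ab fr by auto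
  qed
  note * = this
  have False if "0 \<le> a" "a \<le> T" "0 \<le> b" "b \<le> T'" "\<Phi> a x = \<Phi> b x'" for a b
    using *[of b a T x' x] *[of a b T' x x'] that assms
    by (metis linorder_le_cases)
  then show ?thesis by auto
qed

section \<open>Endpoints on the boundary curve\<close>

text \<open>The second arc passes through the seam of the parametrization, where its parameter set
  is only half-open; compactness comes from the extension \<open>g\<close> to the closed
  interval.\<close>

lemma parametrization_split:
  assumes "parametrization c J" and "0 \<le> m" "m \<le> M" "M < 1"
  shows "compact (c ` {m..M})" "compact (c ` ({0..<1} - {m<..<M}))"
proof -
  obtain g where g: "continuous_on {0..1} g" "\<And>s. s \<in> {0..<1} \<Longrightarrow> g s = c s" "g 1 = g 0"
    using assms(1) unfolding parametrization_def by blast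
  have "c ` {m..M} = g ` {m..M}"
    by (rule image_cong) (use g assms in auto)
  then show "compact (c ` {m..M})"
    using assms by (auto intro!: compact_continuous_image continuous_on_subset[OF g(1)])
  \<comment> \<open>The extra parameter 1 adds no point to the image, since \<open>g 1 = g 0\<close>
    and 0 is already a parameter of this arc.\<close>
  have "{0..m} \<union> {M..1} = insert 1 ({0..<1} - {m<..<M})" using assms by auto
  then have "g ` ({0..m} \<union> {M..1}) = insert (g 0) (g ` ({0..<1} - {m<..<M}))"
    using g(3) by simp
  also have "\<dots> = g ` ({0..<1} - {m<..<M})" using assms by auto
  also have "\<dots> = c ` ({0..<1} - {m<..<M})"
    by (rule image_cong) (use g in auto)
  finally show "compact (c ` ({0..<1} - {m<..<M}))"
    using assms
    by (metis compact_continuous_image[OF continuous_on_subset[OF g(1)]] compact_Un compact_Icc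
        Un_least atLeastatMost_subset_iff order.refl order.trans less_imp_le)
qed

text \<open>The parameters \<open>m < M\<close> are \<open>s\<close> and \<open>u\<close> in
  increasing order, so both directions of the first segment are treated at once.\<close>

lemma first_out_map_endpoints_do_not_link:
  fixes \<Phi> :: "real \<Rightarrow> 'a::euclidean_space \<Rightarrow> 'a"
  assumes dim: "DIM('a) = 2" and flow: "continuous_flow \<Phi>"
    and A: "regular_open A" and J: "Jordan_curve_set (frontier A)"
    and c: "parametrization c (frontier A)"
    and in01: "m \<in> {0..<1}" "M \<in> {0..<1}" "t \<in> {0..<1}" "v \<in> {0..<1}"
    and E: "first_out_map \<Phi> A (c s) = Some (c u)" "first_out_map \<Phi> A (c t) = Some (c v)"
    and su: "{s, u} = {m, M}" "m < M"
    and ne: "t \<noteq> v" "t \<noteq> s" "t \<noteq> u" "v \<noteq> s"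
  shows "v \<noteq> u \<and> (t \<in> {m<..<M} \<longleftrightarrow> v \<in> {m<..<M})"
proof -
  have inj: "inj_on c {0..<1}" and im: "c ` {0..<1} = frontier A"
    using c by (auto simp: parametrization_def bij_betw_def)
  have ceq: "c a = c b \<longleftrightarrow> a = b" if "a \<in> {0..<1}" "b \<in> {0..<1}" for a b
    using inj that by (auto dest: inj_onD)
  have su01: "s \<in> {0..<1}" "u \<in> {0..<1}" "s \<noteq> u" using su in01 by (auto simp: doubleton_eq_iff)
  have oA: "open A" using A by (simp add: regular_open_def)
  have fr: "frontier A \<inter> A = {}" using oA by (auto simp: frontier_def interior_open)
  have zero: "\<Phi> 0 z = z" for z using flow by (auto simp: continuous_flow_def)
  obtain T where T: "T > 0" "\<Phi> T (c s) = c u" "\<And>r. 0 < r \<Longrightarrow> r < T \<Longrightarrow> \<Phi> r (c s) \<in> A"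
    using first_out_map_segment[OF flow E(1)] su01 ceq by metis
  obtain T' where T': "T' > 0" "\<Phi> T' (c t) = c v" "\<And>r. 0 < r \<Longrightarrow> r < T' \<Longrightarrow> \<Phi> r (c t) \<in> A"
    using first_out_map_segment[OF flow E(2)] ne in01 ceq by metis
  define \<alpha> \<beta> where "\<alpha> = (\<lambda>r. \<Phi> r (c s)) ` {0..T}" and "\<beta> = (\<lambda>r. \<Phi> r (c t)) ` {0..T'}"
  have disj: "\<alpha> \<inter> \<beta> = {}"
    unfolding \<alpha>_def \<beta>_def
  proof (rule orbit_segments_disjoint[OF flow oA])
    show "c s \<in> frontier A" "c t \<in> frontier A" using im su01 in01 by auto
    show "c s \<noteq> c t" "\<Phi> T (c s) \<noteq> c t" "\<Phi> T' (c t) \<noteq> c s"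
      using T(2) T'(2) ceq su01 in01 ne by metis+
  qed (use T T' in auto)
  have ends: "c s \<in> \<alpha>" "c u \<in> \<alpha>" "c t \<in> \<beta>" "c v \<in> \<beta>"
    unfolding \<alpha>_def \<beta>_def using T(1,2) T'(1,2) zero
    by (auto intro: rev_image_eqI[of 0] rev_image_eqI[of T] rev_image_eqI[of T'])
  have vu: "v \<noteq> u" using disj ends by auto
  have \<alpha>: "compact \<alpha>" "connected \<alpha>" "\<alpha> \<subseteq> closure A"
  proof -
    show "compact \<alpha>" "connected \<alpha>"
      unfolding \<alpha>_def
      by (auto intro!: compact_continuous_image connected_continuous_image continuous_flow_orbit[OF flow])
    have "\<Phi> r (c s) \<in> A \<union> frontier A" if "0 \<le> r" "r \<le> T" for r
      using that T zero im su01 by (cases "r = 0 \<or> r = T") auto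
    then show "\<alpha> \<subseteq> closure A"
      unfolding \<alpha>_def closure_Un_frontier by fastforce
  qed
  \<comment> \<open>Any time strictly between 0 and \<open>T'\<close> would do.\<close>
  define q where "q = \<Phi> (T' / 2) (c t)"
  have q: "q \<in> A" using T' by (simp add: q_def)
  \<comment> \<open>The second segment without its last and without its first point: each part meets
    the boundary in one point only, hence only one of the arcs.\<close>
  define \<beta>0 \<beta>1 where "\<beta>0 = (\<lambda>r. \<Phi> r (c t)) ` {0..<T'}" and "\<beta>1 = (\<lambda>r. \<Phi> r (c t)) ` {0<..T'}"
  have co: "connected \<beta>0" "connected \<beta>1"
    unfolding \<beta>0_def \<beta>1_def
    by (auto intro!: connected_continuous_image continuous_flow_orbit[OF flow])
  have sub: "\<beta>0 \<subseteq> insert (c t) A" "\<beta>1 \<subseteq> insert (c v) A" "\<beta>0 \<inter> \<alpha> = {}" "\<beta>1 \<inter> \<alpha> = {}"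
  proof -
    show "\<beta>0 \<subseteq> insert (c t) A" using T'(3) zero unfolding \<beta>0_def
      by (auto simp: less_eq_real_def)
    show "\<beta>1 \<subseteq> insert (c v) A" using T'(2,3) unfolding \<beta>1_def
      by (auto simp: less_eq_real_def)
    have "\<beta>0 \<subseteq> \<beta>" "\<beta>1 \<subseteq> \<beta>" by (auto simp: \<beta>0_def \<beta>1_def \<beta>_def)
    then show "\<beta>0 \<inter> \<alpha> = {}" "\<beta>1 \<inter> \<alpha> = {}" using disj by auto
  qed
  have mem: "c t \<in> \<beta>0" "q \<in> \<beta>0" "c v \<in> \<beta>1" "q \<in> \<beta>1"
    unfolding \<beta>0_def \<beta>1_def q_def using T'(1,2) zero
    by (auto intro: rev_image_eqI[of 0] rev_image_eqI[of T'])
  define J1 J2 where "J1 = c ` {m..M}" and "J2 = c ` ({0..<1} - {m<..<M})"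
  have J12: "frontier A = J1 \<union> J2" "compact J1" "compact J2"
  proof -
    have "{m..M} \<union> ({0..<1} - {m<..<M}) = {0..<1}" using in01 by auto
    then show "frontier A = J1 \<union> J2" unfolding J1_def J2_def im[symmetric] by (metis image_Un)
    show "compact J1" "compact J2"
      unfolding J1_def J2_def using parametrization_split[OF c, of m M] in01 su by auto
  qed
  have "J1 \<inter> J2 = c ` ({m..M} \<inter> ({0..<1} - {m<..<M}))"
    unfolding J1_def J2_def using in01 by (intro inj_on_image_Int[OF inj, symmetric]) auto
  also have "{m..M} \<inter> ({0..<1} - {m<..<M}) = {m, M}" using in01 su(2) by auto
  also have "\<dots> = {s, u}" using su(1) by simp
  finally have J12\<alpha>: "J1 \<inter> J2 \<subseteq> \<alpha>" using ends by auto
  have memJ: "c r \<in> J1 \<longleftrightarrow> r \<in> {m..M}" "c r \<in> J2 \<longleftrightarrow> r \<notin> {m<..<M}" if "r \<in> {0..<1}" for r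
    unfolding J1_def J2_def using that in01
    by (subst inj_on_image_mem_iff[OF inj that]; auto)+
  \<comment> \<open>The arc \<open>J1\<close> contains its end points, so lying outside the open
    interval is not yet lying off \<open>J1\<close>.\<close>
  have off: "r \<noteq> m" "r \<noteq> M" if "r \<in> {t, v}" for r
    using that su ne vu by (auto simp: doubleton_eq_iff)
  have JA: "(J1 \<union> J2) \<inter> A = {}" using J12(1) fr by simp
  have False if tv: "t \<in> {m<..<M}" "v \<notin> {m<..<M}"
  proof (rule crosscuts_do_not_link[OF dim A J J12 \<alpha> J12\<alpha> q co(1) mem(1,2) _ _ co(2) mem(3,4)])
    show "c t \<in> J1" "c v \<in> J2" using memJ tv in01 by auto
    have "c t \<notin> J2" "c v \<notin> J1" using memJ tv in01 off[of v] by auto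
    then show "\<beta>0 \<inter> (J2 \<union> \<alpha>) = {}" "\<beta>1 \<inter> (J1 \<union> \<alpha>) = {}" using sub JA by blast+
  qed
  moreover have False if tv: "v \<in> {m<..<M}" "t \<notin> {m<..<M}"
  proof (rule crosscuts_do_not_link[OF dim A J J12 \<alpha> J12\<alpha> q co(2) mem(3,4) _ _ co(1) mem(1,2)])
    show "c v \<in> J1" "c t \<in> J2" using memJ tv in01 by auto
    have "c v \<notin> J2" "c t \<notin> J1" using memJ tv in01 off[of t] by auto
    then show "\<beta>1 \<inter> (J2 \<union> \<alpha>) = {}" "\<beta>0 \<inter> (J1 \<union> \<alpha>) = {}" using sub JA by blast+
  qed
  ultimately show ?thesis using vu by blast
qed

theorem theoremB:
  fixes \<Phi> :: "real \<Rightarrow> real ^ 2 \<Rightarrow> real ^ 2"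
    and A :: "(real ^ 2) set"
    and c :: "real \<Rightarrow> real ^ 2"
    and F_E :: "real \<rightharpoonup> real"
    and s :: real
  assumes "continuous_flow \<Phi>"
    and "regular_open A"
    and "Jordan_curve_set (frontier A)"
    and "parametrization c (frontier A)"
    and "parametric_rep c (first_out_map \<Phi> A) F_E"
    and "s \<in> dom F_E"
    and "continuous (at s within dom F_E) (\<lambda>t. the (F_E t))"
    and "the (F_E s) \<noteq> s"
  shows "\<exists>\<delta>>0. \<forall>t\<in>dom F_E.
           (s - \<delta> < t \<and> t < s \<longrightarrow> the (F_E t) > the (F_E s)) \<and>
           (s < t \<and> t < s + \<delta> \<longrightarrow> the (F_E t) < the (F_E s))"
proof -
  define f where "f t = the (F_E t)" for t
  have f: "t \<in> {0..<1}" "f t \<in> {0..<1}" "first_out_map \<Phi> A (c t) = Some (c (f t))"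
    if "t \<in> dom F_E" for t
  proof -
    have rep: "dom F_E = {s \<in> {0..<1}. c s \<in> dom (first_out_map \<Phi> A)}" "ran F_E \<subseteq> {0..<1}"
      and E: "\<And>s. s \<in> dom F_E \<Longrightarrow> first_out_map \<Phi> A (c s) = Some (c (f s))"
      using assms(5) by (auto simp: parametric_rep_def f_def)
    have "F_E t = Some (f t)" using that by (auto simp: f_def)
    then show "f t \<in> {0..<1}" using rep(2) by (auto dest: ranI)
    show "t \<in> {0..<1}" using that rep(1) by blast
    show "first_out_map \<Phi> A (c t) = Some (c (f t))" by (rule E[OF that])
  qed
  \<comment> \<open>With \<open>t\<close> within \<open>e\<close> of \<open>s\<close> and
    \<open>f t\<close> within \<open>e\<close> of \<open>f s\<close>, the two pairs keep apart:
    \<open>t\<close> and \<open>f t\<close> are ordered like \<open>s\<close> and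
    \<open>f s\<close>, and neither meets the opposite point.\<close>
  define e where "e = \<bar>f s - s\<bar> / 2"
  have e: "e > 0" using assms(8) by (simp add: e_def f_def)
  then obtain d where d: "d > 0" "\<And>t. t \<in> dom F_E \<Longrightarrow> \<bar>t - s\<bar> < d \<Longrightarrow> \<bar>f t - f s\<bar> < e"
    using assms(7) unfolding continuous_within_eps_delta dist_real_def f_def by blast
  have "(t < s \<longrightarrow> f t > f s) \<and> (s < t \<longrightarrow> f t < f s)"
    if t: "t \<in> dom F_E" "\<bar>t - s\<bar> < min d e" for t
  proof (cases "t = s")
    case False
    have near: "\<bar>f t - f s\<bar> < e" "\<bar>t - s\<bar> < e" using d(2)[of t] t by auto
    then have ne: "t \<noteq> f t" "t \<noteq> f s" "f t \<noteq> s"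
      unfolding e_def by (smt (verit) field_sum_of_halves)+
    have "f t \<noteq> f s \<and> (t \<in> {min s (f s)<..<max s (f s)} \<longleftrightarrow> f t \<in> {min s (f s)<..<max s (f s)})"
    proof (rule first_out_map_endpoints_do_not_link[OF _ assms(1-4)])
      show "{s, f s} = {min s (f s), max s (f s)}" by (auto simp: min_def max_def)
      show "min s (f s) < max s (f s)" using e by (auto simp: e_def min_def max_def)
    qed (use f[OF t(1)] f[OF assms(6)] ne False in auto)
    \<comment> \<open>If \<open>s < f s\<close>, then \<open>t < s\<close> lies outside the
      interval, so \<open>f t\<close>, being close to \<open>f s\<close>, lies beyond
      \<open>f s\<close>; \<open>t > s\<close> lies inside, so \<open>f t\<close> stays below. If
      \<open>f s < s\<close>, inside and outside change places, with the same inequalities.\<close>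
    then show ?thesis
      using near False unfolding e_def by (auto simp: min_def max_def split: if_splits)
  qed simp
  then have "\<forall>t\<in>dom F_E. (s - min d e < t \<and> t < s \<longrightarrow> f t > f s) \<and>
      (s < t \<and> t < s + min d e \<longrightarrow> f t < f s)"
    by (smt (verit))
  then show ?thesis
    using d(1) e unfolding f_def by (intro exI[of _ "min d e"]) auto
qed

end
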